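(* Let $m,n$ be integers with $0\le m\le n$. Then, for all complex $x$ with $|x|<\tfrac12$, $$Hl\left(\tfrac12,(2m+1)(m-n);\,2(m-n),\,2m+1;\,m+1,\,m+1;\,x\right)=4^m\binom{n}{m}^{-1}\binom{2m}{m}^{-1}\sum_{j=0}^{n-m}\binom{m+j}{m}a_{n,m+j}(1-2x)^{2j}$$ and $$Hl\left(\tfrac12,(2m+1)(m-n);\,2(m-n),\,2m+1;\,m+1,\,m+1;\,x\right)=\sum_{j=0}^{n-m}4^j\binom{n-m}{j}\frac{(m+1/2)_j}{(m+1)_j}(x^2-x)^j.$$
   Context: Heun function: for $a\notin\{0,1\}$, $\gamma\notin\{0,-1,-2,\dots\}$ and $\epsilon$ defined by $\alpha+\beta+1=\gamma+\delta+\epsilon$, $Hl(a,q;\alpha,\beta;\gamma,\delta;x)$ denotes the (local) Heun function, i.e. the solution $u(x)$, analytic near $x=0$ and normalized by $u(0)=1$, of $$u''(x)+\left(\frac{\gamma}{x}+\frac{\delta}{x-1}+\frac{\epsilon}{x-a}\right)u'(x)+\frac{\alpha\beta x-q}{x(x-1)(x-a)}u(x)=0.$$ (For $a=\tfrac12$ its power series at $0$ converges for $|x|<\tfrac12$.) Notation: $(y)_0:=1$, $(y)_k:=y(y+1)\cdots(y+k-1)$ for $k\ge1$; $a_{nj}:=4^{-n}\binom{2j}{j}\binom{2n-2j}{n-j}$ for $0\le j\le n$ (also written $a_{n,j}$). *)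

theory Defs
  imports "HOL-Complex_Analysis.Complex_Analysis"
begin

text \<open>
  The Heun equation, required on a punctured neighbourhood of the singular point \<open>0\<close>, together
  with analyticity at \<open>0\<close> and the normalization. The exponent \<open>\<epsilon>\<close> at the singular point \<open>a\<close> is not
  an independent parameter: it is fixed by \<open>\<alpha> + \<beta> + 1 = \<gamma> + \<delta> + \<epsilon>\<close>.
\<close>
definition local_heun_solution ::
  "complex \<Rightarrow> complex \<Rightarrow> complex \<Rightarrow> complex \<Rightarrow> complex \<Rightarrow> complex \<Rightarrow> (complex \<Rightarrow> complex) \<Rightarrow> bool"
where
  "local_heun_solution a q \<alpha> \<beta> \<gamma> \<delta> u \<longleftrightarrow>
     (let \<epsilon> = \<alpha> + \<beta> + 1 - \<gamma> - \<delta> in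
       u analytic_on {0} \<and> u 0 = 1 \<and>
       (\<forall>\<^sub>F x in at 0.
          deriv (deriv u) x + (\<gamma> / x + \<delta> / (x - 1) + \<epsilon> / (x - a)) * deriv u x
            + (\<alpha> * \<beta> * x - q) / (x * (x - 1) * (x - a)) * u x = 0))"

text \<open>
  A local solution is determined only as a germ at \<open>0\<close>, so \<open>Hl\<close> is the sum of its power series
  at \<open>0\<close>. The definite description is meaningful for \<open>a \<notin> {0, 1}\<close> and \<open>\<gamma> \<notin> {0, -1, -2, \<dots>}\<close>; the
  value \<open>Hl \<dots> x\<close> is meaningful for \<open>x\<close> inside the disc of convergence.
\<close>
definition Hl ::
  "complex \<Rightarrow> complex \<Rightarrow> complex \<Rightarrow> complex \<Rightarrow> complex \<Rightarrow> complex \<Rightarrow> complex \<Rightarrow> complex"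
where
  "Hl a q \<alpha> \<beta> \<gamma> \<delta> x =
     eval_fps (THE F. \<exists>u. local_heun_solution a q \<alpha> \<beta> \<gamma> \<delta> u \<and> u has_fps_expansion F) x"

text \<open>Intended for \<open>j \<le> n\<close>, where the subtractions on \<^typ>\<open>nat\<close> are exact.\<close>
definition a_coeff :: "nat \<Rightarrow> nat \<Rightarrow> complex" where
  "a_coeff n j = inverse (4 ^ n) * of_nat ((2 * j) choose j) * of_nat ((2 * n - 2 * j) choose (n - j))"

end

theory Submission
  imports Defs
begin

text \<open>
  With \<open>a = 1/2\<close> and equal exponents \<open>\<gamma> = \<delta>\<close> at \<open>0\<close> and \<open>1\<close>, and with \<open>q = \<alpha>\<beta>/2\<close>, the Heun equation
  is invariant under the reflection \<open>x \<mapsto> 1 - x\<close>, whose invariant is \<open>z = x\<^sup>2 - x\<close>. In the variable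
  \<open>z\<close> it loses a singular point: both \<open>0\<close> and \<open>1\<close> lie over \<open>z = 0\<close>, the point \<open>1/2\<close> lies over
  \<open>z = -1/4\<close>, and what remains is the Gauss hypergeometric equation in \<open>-4z\<close> with parameters
  \<open>\<alpha>/2, \<beta>/2, \<gamma>\<close>. For \<open>\<alpha>/2 = -(n-m)\<close> the series in \<open>z\<close> terminates, which gives the formula in powers
  of \<open>x\<^sup>2 - x\<close> (lemmas \<open>hypergeometric_poly_ode\<close>, \<open>local_heun_solution_quadratic\<close>,
  \<open>Hl_hypergeometric_poly\<close>).

  That this polynomial really is the function \<open>Hl\<close> needs the uniqueness of the normalized analytic
  solution. It follows from the Frobenius recurrence at \<open>0\<close>, whose indicial factor \<open>(k + 1)(k + \<gamma>)\<close>
  does not vanish (\<open>fps_frobenius_eq_0\<close>, \<open>local_heun_solution_fps_unique\<close>).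

  The formula in powers of \<open>y = (1 - 2x)\<^sup>2\<close> is the same polynomial expanded at the image of
  \<open>x = 1/2\<close>, because \<open>4(x\<^sup>2 - x) = y - 1\<close>. Expanding \<open>(y - 1)\<^sup>j\<close> binomially leaves, for each power of
  \<open>y\<close>, a terminating hypergeometric sum at \<open>1\<close>, evaluated by Chu--Vandermonde
  (\<open>hypergeometric_poly_reexpand\<close>).
\<close>

section \<open>Uniqueness of the local solution\<close>

lemma fps_mult_nth_lowest:
  fixes A H :: "'a::comm_ring_1 fps"
  assumes "\<And>j. j < n \<Longrightarrow> H $ j = 0"
  shows "(A * H) $ n = A $ 0 * H $ n"
proof -
  have "(A * H) $ n = (\<Sum>i=0..n. A $ i * H $ (n - i))"
    by (simp add: fps_mult_nth)
  also have "\<dots> = (\<Sum>i\<in>{0}. A $ i * H $ (n - i))"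
    by (rule sum.mono_neutral_right) (auto simp: assms)
  finally show ?thesis by simp
qed

text \<open>
  The equation has a regular singular point at \<open>0\<close>. If all coefficients of \<open>F\<close> up to index \<open>i\<close>
  vanish, only the constant terms of \<open>A\<close> and \<open>B\<close> contribute to the coefficient of index \<open>i\<close> of the
  equation, which becomes \<open>(i A\<^sub>0 + B\<^sub>0)(i + 1) F\<^sub>i\<^sub>+\<^sub>1 = 0\<close>. So \<open>nonres\<close> excludes a second
  integer exponent above \<open>0\<close>.
\<close>

lemma fps_frobenius_eq_0:
  fixes A B C F :: "'a::field_char_0 fps"
  assumes ode: "fps_X * A * fps_deriv (fps_deriv F) + B * fps_deriv F + C * F = 0"
    and nonres: "\<And>k. of_nat k * A $ 0 + B $ 0 \<noteq> 0"
    and F0: "F $ 0 = 0"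
  shows "F = 0"
proof -
  have "F $ k = 0" for k
  proof (induction k rule: less_induct)
    case (less k)
    show ?case
    proof (cases k)
      case 0
      then show ?thesis using F0 by simp
    next
      case (Suc i)
      have low: "F $ j = 0" if "j \<le> i" for j
        using less Suc that by simp
      have XF: "(fps_X * fps_deriv (fps_deriv F)) $ j = of_nat j * (of_nat (Suc j) * F $ Suc j)" for j
        by (cases j) simp_all
      have "(A * (fps_X * fps_deriv (fps_deriv F))) $ i
              = A $ 0 * (of_nat i * (of_nat (Suc i) * F $ Suc i))"
        by (subst fps_mult_nth_lowest) (simp_all add: XF low del: of_nat_Suc)
      moreover have "(B * fps_deriv F) $ i = B $ 0 * (of_nat (Suc i) * F $ Suc i)"
        by (subst fps_mult_nth_lowest) (simp_all add: low)
      moreover have "(C * F) $ i = 0"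
        by (subst fps_mult_nth_lowest) (simp_all add: low)
      moreover have "(A * (fps_X * fps_deriv (fps_deriv F)) + B * fps_deriv F + C * F) $ i = 0"
        using ode by (simp add: mult_ac)
      ultimately have "(of_nat i * A $ 0 + B $ 0) * (of_nat (Suc i) * F $ Suc i) = 0"
        by (simp add: algebra_simps del: of_nat_Suc)
      then show ?thesis
        using nonres[of i] Suc by (simp del: of_nat_Suc)
    qed
  qed
  then show ?thesis by (simp add: fps_eq_iff)
qed

text \<open>
  The Heun equation is only required near, but not at, the point \<open>0\<close>, where its coefficients have a
  pole. After multiplication by \<open>x(x-1)(x-a)\<close> the left-hand side is analytic, so it vanishes at \<open>0\<close>
  by continuity, and the equation can be compared coefficient by coefficient.
\<close>

lemma local_heun_solution_fps_ode:
  fixes a q \<alpha> \<beta> \<gamma> \<delta> :: complex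
  assumes sol: "local_heun_solution a q \<alpha> \<beta> \<gamma> \<delta> u" and exp: "u has_fps_expansion F"
    and "a \<noteq> 0"
  defines "\<epsilon> \<equiv> \<alpha> + \<beta> + 1 - \<gamma> - \<delta>"
  shows "fps_X * ((fps_X - 1) * (fps_X - fps_const a)) * fps_deriv (fps_deriv F)
         + (fps_const \<gamma> * ((fps_X - 1) * (fps_X - fps_const a))
            + fps_const \<delta> * (fps_X * (fps_X - fps_const a))
            + fps_const \<epsilon> * (fps_X * (fps_X - 1))) * fps_deriv F
         + (fps_const (\<alpha> * \<beta>) * fps_X - fps_const q) * F = 0"
    (is "?G = 0")
proof -
  define g where "g = (\<lambda>x. x * ((x - 1) * (x - a)) * deriv (deriv u) x
      + (\<gamma> * ((x - 1) * (x - a)) + \<delta> * (x * (x - a)) + \<epsilon> * (x * (x - 1))) * deriv u x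
      + (\<alpha> * \<beta> * x - q) * u x)"
  have G: "g has_fps_expansion ?G"
    unfolding g_def by (intro fps_expansion_intros exp)
  have "\<forall>\<^sub>F x in at 0. x \<noteq> (0::complex)"
    by (simp add: eventually_at_filter)
  moreover have "\<forall>\<^sub>F x in at 0. x \<noteq> (1::complex)" "\<forall>\<^sub>F x in at 0. x \<noteq> a"
    using \<open>a \<noteq> 0\<close> by (simp_all add: eventually_neq_at_within)
  moreover have "\<forall>\<^sub>F x in at 0. deriv (deriv u) x + (\<gamma> / x + \<delta> / (x - 1) + \<epsilon> / (x - a)) * deriv u x
            + (\<alpha> * \<beta> * x - q) / (x * (x - 1) * (x - a)) * u x = 0"
    using sol by (simp add: local_heun_solution_def Let_def \<epsilon>_def)
  ultimately have "\<forall>\<^sub>F x in at 0. g x = 0"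
  proof eventually_elim
    case (elim x)
    have ne: "x \<noteq> 0" "x - 1 \<noteq> 0" "x - a \<noteq> 0" using elim by auto
    have "g x = x * ((x - 1) * (x - a)) *
       (deriv (deriv u) x + (\<gamma> / x + \<delta> / (x - 1) + \<epsilon> / (x - a)) * deriv u x
            + (\<alpha> * \<beta> * x - q) / (x * (x - 1) * (x - a)) * u x)"
    proof -
      have c: "x * ((x - 1) * (x - a)) * (\<gamma> / x + \<delta> / (x - 1) + \<epsilon> / (x - a))
         = \<gamma> * ((x - 1) * (x - a)) + \<delta> * (x * (x - a)) + \<epsilon> * (x * (x - 1))"
        using ne by (simp add: distrib_left mult_ac)
      show ?thesis
        unfolding g_def c[symmetric] using ne by (simp add: distrib_left mult.assoc)
    qed
    then show ?case using elim by simp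
  qed
  moreover have "g 0 = 0"
  proof -
    have "isCont g 0" using has_fps_expansion_imp_continuous[OF G] by simp
    then have "(g \<longlongrightarrow> g 0) (at 0)" by (simp add: isCont_def)
    moreover have "(g \<longlongrightarrow> 0) (at 0)"
      using \<open>\<forall>\<^sub>F x in at 0. g x = 0\<close> by (rule tendsto_eventually)
    ultimately show ?thesis by (rule LIM_unique)
  qed
  ultimately have "\<forall>\<^sub>F x in nhds 0. g x = 0"
    by (auto simp: eventually_at_filter elim: eventually_mono)
  then have "g has_fps_expansion 0"
    using has_fps_expansion_cong[of g "\<lambda>_. 0" 0 0] by simp
  then show ?thesis by (rule fps_expansion_unique_complex[OF G])
qed

text \<open>
  The difference of two normalized solutions has zero constant term and satisfies the same linear
  equation; here \<open>k A\<^sub>0 + B\<^sub>0 = (k + \<gamma>) a\<close>.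
\<close>

lemma local_heun_solution_fps_unique:
  fixes a q \<alpha> \<beta> \<gamma> \<delta> :: complex
  assumes "a \<noteq> 0" and \<gamma>: "\<And>k. \<gamma> \<noteq> - of_nat k"
    and u: "local_heun_solution a q \<alpha> \<beta> \<gamma> \<delta> u" "u has_fps_expansion F"
    and v: "local_heun_solution a q \<alpha> \<beta> \<gamma> \<delta> v" "v has_fps_expansion G"
  shows "F = G"
proof -
  define A where "A = (fps_X - 1) * (fps_X - fps_const a)"
  define B where "B = fps_const \<gamma> * A
            + fps_const \<delta> * (fps_X * (fps_X - fps_const a))
            + fps_const (\<alpha> + \<beta> + 1 - \<gamma> - \<delta>) * (fps_X * (fps_X - 1))"
  define C where "C = fps_const (\<alpha> * \<beta>) * fps_X - fps_const q"
  note ode = local_heun_solution_fps_ode[OF _ _ \<open>a \<noteq> 0\<close>, folded A_def B_def C_def]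
  have "F - G = 0"
  proof (rule fps_frobenius_eq_0)
    have "fps_X * A * fps_deriv (fps_deriv (F - G)) + B * fps_deriv (F - G) + C * (F - G)
        = (fps_X * A * fps_deriv (fps_deriv F) + B * fps_deriv F + C * F)
        - (fps_X * A * fps_deriv (fps_deriv G) + B * fps_deriv G + C * G)"
      by (simp add: algebra_simps)
    then show "fps_X * A * fps_deriv (fps_deriv (F - G)) + B * fps_deriv (F - G) + C * (F - G) = 0"
      using ode[OF u, folded B_def C_def] ode[OF v, folded B_def C_def] by simp
  next
    fix k
    have "of_nat k * A $ 0 + B $ 0 = (of_nat k + \<gamma>) * a"
      by (simp add: A_def B_def algebra_simps)
    moreover have "of_nat k + \<gamma> \<noteq> 0"
      using \<gamma>[of k] by (metis add.commute add_eq_0_iff)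
    ultimately show "of_nat k * A $ 0 + B $ 0 \<noteq> 0"
      using \<open>a \<noteq> 0\<close> by simp
  next
    show "(F - G) $ 0 = 0"
      using has_fps_expansion_imp_0_eq_fps_nth_0[OF u(2)] has_fps_expansion_imp_0_eq_fps_nth_0[OF v(2)] u(1) v(1)
      by (simp add: local_heun_solution_def Let_def)
  qed
  then show ?thesis by simp
qed

lemma poly_has_fps_expansion: "poly P has_fps_expansion fps_of_poly (P :: complex poly)"
  by (simp add: has_fps_expansion_def)

lemma Hl_eq_poly:
  assumes "a \<noteq> 0" "\<And>k. \<gamma> \<noteq> - of_nat k"
    and sol: "local_heun_solution a q \<alpha> \<beta> \<gamma> \<delta> (poly P)"
  shows "Hl a q \<alpha> \<beta> \<gamma> \<delta> x = poly P x"
proof -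
  have "(THE F. \<exists>u. local_heun_solution a q \<alpha> \<beta> \<gamma> \<delta> u \<and> u has_fps_expansion F) = fps_of_poly P"
    using sol poly_has_fps_expansion[of P] local_heun_solution_fps_unique[OF assms(1,2)]
    by (intro the_equality) blast+
  then show ?thesis by (simp add: Hl_def)
qed

section \<open>Quadratic transformation of a hypergeometric polynomial\<close>

text \<open>
  This is the Gauss equation \<open>t(1-t) f'' + (c - (a+b+1) t) f' - ab f = 0\<close> after the substitution
  \<open>t = -4z\<close>. It is equivalent to the term ratio of the hypergeometric series, and is kept at
  the level of polynomials so that it can be evaluated at \<open>z = x\<^sup>2 - x\<close>.
\<close>

lemma hypergeometric_poly_ode:
  fixes p :: "complex poly"
  assumes rec: "\<And>j. of_nat (Suc j) * (of_nat j + c) * coeff p (Suc j)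
                     = - 4 * (of_nat j + a) * (of_nat j + b) * coeff p j"
  shows "[:0, 1, 4:] * pderiv (pderiv p) + [:c, 4 * (a + b + 1):] * pderiv p
           + smult (4 * a * b) p = 0"
proof (rule poly_eqI)
  fix j
  have "coeff ([:0, 1, 4:] * pderiv (pderiv p) + [:c, 4 * (a + b + 1):] * pderiv p
           + smult (4 * a * b) p) j
     = of_nat (Suc j) * (of_nat j + c) * coeff p (Suc j)
       + 4 * (of_nat j + a) * (of_nat j + b) * coeff p j"
  proof (cases j)
    case 0
    then show ?thesis
      by (simp add: coeff_pderiv algebra_simps)
  next
    case (Suc i)
    then show ?thesis
      by (cases i) (simp_all add: coeff_pderiv algebra_simps)
  qed
  also have "\<dots> = 0"
    by (simp only: rec) (simp add: algebra_simps)
  finally show "coeff ([:0, 1, 4:] * pderiv (pderiv p) + [:c, 4 * (a + b + 1):] * pderiv p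
           + smult (4 * a * b) p) j = coeff 0 j"
    by (simp only: coeff_0)
qed

text \<open>
  The quadratic transformation. With \<open>w = 2x - 1 = dz/dx\<close> one has \<open>w\<^sup>2 = 1 + 4z\<close>, and the condition
  \<open>q = \<alpha>\<beta>/2\<close> makes the factor \<open>x - 1/2\<close> cancel in the last term of the Heun equation. Hence
  every odd power of \<open>w\<close> is paired with another one, and the equation is expressible in \<open>z\<close> alone.
\<close>

lemma local_heun_solution_quadratic:
  fixes p :: "complex poly"
  assumes ode: "[:0, 1, 4:] * pderiv (pderiv p) + [:c, 4 * (a + b + 1):] * pderiv p
           + smult (4 * a * b) p = 0"
    and p0: "poly p 0 = 1"
  shows "local_heun_solution (1/2) (2 * a * b) (2 * a) (2 * b) c c (poly (pcompose p [:0, -1, 1:]))"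
proof -
  let ?P = "pcompose p [:0, -1, 1:]"
  define \<epsilon> where "\<epsilon> = 2 * a + 2 * b + 1 - c - c"
  have d: "deriv (poly Q) = poly (pderiv Q)" for Q :: "complex poly"
    by (auto intro!: DERIV_imp_deriv)
  have "\<forall>\<^sub>F x in at 0. x \<noteq> (0::complex)"
    by (simp add: eventually_at_filter)
  moreover have "\<forall>\<^sub>F x in at 0. x \<noteq> (1::complex)" "\<forall>\<^sub>F x in at 0. x \<noteq> (1/2::complex)"
    by (simp_all only: eventually_neq_at_within)
  ultimately have ev: "\<forall>\<^sub>F x in at 0. deriv (deriv (poly ?P)) x
          + (c / x + c / (x - 1) + \<epsilon> / (x - 1/2)) * deriv (poly ?P) x
          + (2 * a * (2 * b) * x - 2 * a * b) / (x * (x - 1) * (x - 1/2)) * poly ?P x = 0"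
  proof eventually_elim
    case (elim x)
    define z where "z = x\<^sup>2 - x"
    define w where "w = 2 * x - 1"
    define p0 p1 p2 where "p0 = poly p z" "p1 = poly (pderiv p) z" "p2 = poly (pderiv (pderiv p)) z"
    have nz: "z \<noteq> 0" "w \<noteq> 0" "x \<noteq> 0" "x - 1 \<noteq> 0"
      using elim by (auto simp: z_def w_def power2_eq_square mult.commute[of 2])
    have w2: "w * w = 1 + 4 * z"
      by (simp add: w_def z_def power2_eq_square algebra_simps)
    have eqn: "z * (1 + 4 * z) * p2 + (c + 4 * (a + b + 1) * z) * p1 + 4 * a * b * p0 = 0"
      using arg_cong[OF ode, of "\<lambda>q. poly q z"] by (simp add: p0_p1_p2_def algebra_simps)
    have c1: "c / x + c / (x - 1) = c * w / z"
      using nz by (simp add: field_simps z_def w_def power2_eq_square)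
    have c2: "\<epsilon> / (x - 1/2) = 2 * \<epsilon> / w"
    proof -
      have "x - 1/2 = w / 2" by (simp add: w_def field_simps)
      show ?thesis unfolding \<open>x - 1/2 = w / 2\<close> by simp
    qed
    have c3: "(2 * a * (2 * b) * x - 2 * a * b) / (x * (x - 1) * (x - 1/2)) = 4 * a * b / z"
    proof -
      have h: "2 * a * (2 * b) * x - 2 * a * b = 4 * a * b * (w / 2)"
        "x * (x - 1) * (x - 1/2) = z * (w / 2)"
        by (simp_all add: w_def z_def power2_eq_square field_simps)
      show ?thesis unfolding h using nz by simp
    qed
    have zz: "poly [:0, -1, 1:] x = z" by (simp add: z_def power2_eq_square algebra_simps)
    have dq: "poly (pderiv [:0, -1, 1:]) x = w" by (simp add: w_def pderiv_pCons)
    have ddq: "poly (pderiv (pderiv [:0, -1, 1:])) x = 2" by (simp add: pderiv_pCons)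
    have P0: "poly ?P x = p0" by (simp add: poly_pcompose p0_p1_p2_def zz del: poly_pCons)
    have P1: "deriv (poly ?P) x = p1 * w"
      by (simp add: d pderiv_pcompose poly_pcompose p0_p1_p2_def zz dq del: poly_pCons)
    have P2: "deriv (deriv (poly ?P)) x = p2 * (w * w) + 2 * p1"
      by (simp add: d pderiv_pcompose pderiv_mult poly_pcompose p0_p1_p2_def zz dq ddq mult.assoc
            del: poly_pCons)
    \<comment> \<open>Multiplying the Heun equation by \<open>z\<close> and cancelling \<open>w\<close> clears the denominators; replacing \<open>w\<^sup>2\<close> by
      \<open>1 + 4z\<close> then gives the hypergeometric equation.\<close>
    have "z * (p2 * (w * w) + 2 * p1 + (c * w / z + 2 * \<epsilon> / w) * (p1 * w) + 4 * a * b / z * p0)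
        = z * p2 * (w * w) + 2 * z * p1 + c * (w * w) * p1 + 2 * \<epsilon> * z * p1 + 4 * a * b * p0"
      using nz by (simp add: field_simps)
    also have "\<dots> = 0"
      using eqn unfolding w2 \<epsilon>_def by (simp add: algebra_simps)
    finally show ?case
      unfolding P0 P1 P2 c1 c2 c3 using nz by simp
  qed
  show ?thesis
    unfolding local_heun_solution_def Let_def
    using ev p0 unfolding \<epsilon>_def
    by (auto simp: poly_pcompose intro!: has_fps_expansion_imp_analytic_0[OF poly_has_fps_expansion])
qed

text \<open>
  The coefficients of the sum are those of the hypergeometric series with \<open>a = -N\<close>, since
  \<open>(-1)\<^sup>j (-N)\<^sub>j / j!\<close> is the binomial coefficient \<open>N\<close> over \<open>j\<close>; the sign is absorbed in the argument \<open>-4z\<close>.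
\<close>

lemma Hl_hypergeometric_poly:
  fixes b c x :: complex
  assumes c: "\<And>k. c \<noteq> - of_nat k"
  shows "Hl (1/2) (- 2 * of_nat N * b) (- 2 * of_nat N) (2 * b) c c x
    = (\<Sum>j = 0..N. 4 ^ j * of_nat (N choose j) * (pochhammer b j / pochhammer c j) * (x\<^sup>2 - x) ^ j)"
proof -
  define f where "f = (\<lambda>j. 4 ^ j * of_nat (N choose j) * (pochhammer b j / pochhammer c j))"
  define p where "p = (\<Sum>j=0..N. monom (f j) j)"
  have coeff: "coeff p j = f j" for j
    by (auto simp: p_def coeff_sum f_def binomial_eq_0)
  have rec: "of_nat (Suc j) * (of_nat j + c) * coeff p (Suc j)
        = - 4 * (of_nat j + (- of_nat N)) * (of_nat j + b) * coeff p j" for j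
  proof -
    have cj: "c + of_nat j \<noteq> 0" using c[of j] by (metis add_eq_0_iff2)
    have bin: "of_nat (Suc j) * of_nat (N choose Suc j) = (of_nat N - of_nat j) * (of_nat (N choose j) :: complex)"
    proof (cases "j \<le> N")
      case True
      have "Suc j * (N choose Suc j) = (N - j) * (N choose j)"
        by (metis binomial_absorb_comp binomial_absorption mult.commute)
      then show ?thesis using True
        by (metis of_nat_diff of_nat_mult)
    qed (simp add: binomial_eq_0)
    have "of_nat (Suc j) * (of_nat j + c) * coeff p (Suc j)
        = 4 * 4 ^ j * (of_nat (Suc j) * of_nat (N choose Suc j))
            * (pochhammer b j * (b + of_nat j) / pochhammer c j)"
      using cj by (simp add: coeff f_def pochhammer_Suc add.commute[of c] del: of_nat_Suc)
    also have "\<dots> = - 4 * (of_nat j + (- of_nat N)) * (of_nat j + b) * coeff p j"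
      unfolding bin by (simp add: coeff f_def algebra_simps add_divide_distrib)
    finally show ?thesis .
  qed
  have "poly p 0 = 1"
    by (simp add: poly_0_coeff_0 coeff f_def)
  from Hl_eq_poly[OF _ c local_heun_solution_quadratic[OF hypergeometric_poly_ode[OF rec] this]]
  show ?thesis
    by (simp add: poly_pcompose p_def poly_sum poly_monom f_def power2_eq_square algebra_simps)
qed

section \<open>Re-expansion of the polynomial about the other singular point\<close>

text \<open>
  The connection formula between the points \<open>t = 0\<close> and \<open>t = 1\<close> for a terminating hypergeometric
  series in \<open>t = 1 - y\<close>. The coefficient of \<open>y\<^sup>i\<close> is a factor times the series with parameters
  \<open>-(N-i), b + i\<close> over \<open>c + i\<close> at the argument \<open>1\<close>. Chu--Vandermonde sums it, and the
  difference \<open>c - b\<close> in the result does not depend on \<open>i\<close>.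
\<close>

lemma hypergeometric_poly_reexpand:
  fixes b c y :: "'a::field_char_0"
  assumes c: "\<And>k. c \<noteq> - of_nat k"
  shows "(\<Sum>j=0..N. of_nat (N choose j) * (pochhammer b j / pochhammer c j) * (y - 1) ^ j)
    = (\<Sum>i=0..N. of_nat (N choose i) * (pochhammer b i * pochhammer (c - b) (N - i) / pochhammer c N) * y ^ i)"
proof -
  have nz: "pochhammer c k \<noteq> 0" for k
    using c by (auto simp: pochhammer_eq_0_iff)
  have inner: "(\<Sum>k=0..N-i. of_nat (N choose (i+k)) * (pochhammer b (i+k) / pochhammer c (i+k))
                  * (of_nat ((i+k) choose i) * (-1) ^ k))
      = of_nat (N choose i) * (pochhammer b i * pochhammer (c - b) (N - i) / pochhammer c N)"
    if i: "i \<le> N" for i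
  proof -
    let ?b = "b + of_nat i" and ?c = "c + of_nat i"
    have c': "\<forall>k\<in>{0..<N-i}. ?c \<noteq> - of_nat k"
      using c by (metis add.assoc add_eq_0_iff2 of_nat_add)
    have "(\<Sum>k=0..N-i. of_nat (N choose (i+k)) * (pochhammer b (i+k) / pochhammer c (i+k))
                  * (of_nat ((i+k) choose i) * (-1) ^ k))
      = (\<Sum>k=0..N-i. of_nat (N choose i) * (pochhammer b i / pochhammer c i)
            * (pochhammer ?b k * pochhammer (- of_nat (N - i)) k / (of_nat (fact k) * pochhammer ?c k)))"
    proof (rule sum.cong[OF refl])
      fix k assume "k \<in> {0..N-i}"
      then have k: "i + k \<le> N" using i by auto
      have "of_nat (N choose (i+k)) * of_nat ((i+k) choose i)
          = (of_nat (N choose i) * of_nat ((N - i) choose k) :: 'a)"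
        using k choose_mult[of i "i+k" N] by (simp flip: of_nat_mult)
      moreover have "of_nat ((N - i) choose k) * (-1) ^ k
          = (pochhammer (- of_nat (N - i)) k / fact k :: 'a)"
        by (simp add: binomial_gbinomial gbinomial_pochhammer mult.commute)
      ultimately have "of_nat (N choose (i+k)) * of_nat ((i+k) choose i) * (-1) ^ k
          = (of_nat (N choose i) * (pochhammer (- of_nat (N - i)) k / fact k) :: 'a)"
        by (metis mult.assoc)
      moreover have "pochhammer b (i+k) = pochhammer b i * pochhammer ?b k"
        "pochhammer c (i+k) = pochhammer c i * pochhammer ?c k"
        by (simp_all add: pochhammer_product')
      ultimately show "of_nat (N choose (i+k)) * (pochhammer b (i+k) / pochhammer c (i+k))
                  * (of_nat ((i+k) choose i) * (-1) ^ k)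
         = of_nat (N choose i) * (pochhammer b i / pochhammer c i)
            * (pochhammer ?b k * pochhammer (- of_nat (N - i)) k / (of_nat (fact k) * pochhammer ?c k))"
        by (simp add: mult_ac)
    qed
    also have "\<dots> = of_nat (N choose i) * (pochhammer b i / pochhammer c i)
        * (pochhammer (?c - ?b) (N - i) / pochhammer ?c (N - i))"
      unfolding sum_distrib_left[symmetric] Vandermonde_pochhammer[OF c'] ..
    also have "\<dots> = of_nat (N choose i) * (pochhammer b i * pochhammer (c - b) (N - i) / pochhammer c N)"
      using pochhammer_product[OF i, of c] by simp
    finally show ?thesis .
  qed
  have "(\<Sum>j=0..N. of_nat (N choose j) * (pochhammer b j / pochhammer c j) * (y - 1) ^ j)
      = (\<Sum>j=0..N. \<Sum>i=0..j. of_nat (N choose j) * (pochhammer b j / pochhammer c j)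
            * (of_nat (j choose i) * (-1) ^ (j - i)) * y ^ i)"
    using binomial_ring[of y "-1"]
    by (simp add: sum_distrib_left atLeast0AtMost mult_ac)
  also have "\<dots> = (\<Sum>i=0..N. \<Sum>j=i..N. of_nat (N choose j) * (pochhammer b j / pochhammer c j)
            * (of_nat (j choose i) * (-1) ^ (j - i)) * y ^ i)"
    unfolding sum.Sigma[OF finite_atLeastAtMost ballI[OF finite_atLeastAtMost]]
    by (intro sum.reindex_bij_witness[of _ "\<lambda>(i, j). (j, i)" "\<lambda>(j, i). (i, j)"]) auto
  also have "\<dots> = (\<Sum>i=0..N. (\<Sum>k=0..N-i. of_nat (N choose (i+k)) * (pochhammer b (i+k) / pochhammer c (i+k))
            * (of_nat ((i+k) choose i) * (-1) ^ k)) * y ^ i)"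
    (is "sum ?L _ = sum ?R _")
  proof (rule sum.cong[OF refl])
    fix i assume "i \<in> {0..N}"
    then show "?L i = ?R i"
      unfolding sum_distrib_right
      by (intro sum.reindex_bij_witness[of _ "\<lambda>k. i + k" "\<lambda>j. j - i"]) auto
  qed
  also have "\<dots> = (\<Sum>i=0..N. of_nat (N choose i) * (pochhammer b i * pochhammer (c - b) (N - i) / pochhammer c N) * y ^ i)"
    by (intro sum.cong refl) (simp only: inner atLeastAtMost_iff)
  finally show ?thesis .
qed

text \<open>
  Turns the central binomial coefficients in \<open>a_coeff\<close> into the Pochhammer symbols produced by the
  connection formula.
\<close>

lemma central_binomial_pochhammer:
  "of_nat ((2 * k) choose k) = (4 ^ k * pochhammer (1/2) k / fact k :: 'a::field_char_0)"
  by (simp add: binomial_fact fact_double[of k] power_mult)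

text \<open>
  The prefactor of the expansion in \<open>(1 - 2x)\<^sup>2\<close> is exactly what makes both forms agree: after
  \<open>(1/2)\<^sub>m\<^sub>+\<^sub>i = (1/2)\<^sub>m (m + 1/2)\<^sub>i\<close>, the factor \<open>(1/2)\<^sub>m\<close> cancels the central binomial coefficient of
  \<open>m\<close>, and only factorials are left.
\<close>

lemma reexpansion_coefficient:
  assumes mn: "m \<le> n" and i: "i \<le> n - m"
  shows "4 ^ m * inverse (of_nat (n choose m)) * inverse (of_nat ((2 * m) choose m))
           * (of_nat ((m + i) choose m) * a_coeff n (m + i))
       = of_nat ((n - m) choose i) * (pochhammer (of_nat m + 1 / 2) i * pochhammer (1 / 2) (n - m - i)
            / pochhammer (of_nat m + 1) (n - m))"
proof -
  obtain k where n: "n = m + i + k" using mn i by (metis add.assoc le_add_diff_inverse)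
  have half: "pochhammer (1/2 :: complex) (m + i) = pochhammer (1/2) m * pochhammer (of_nat m + 1/2) i"
    using pochhammer_product'[of "1/2 :: complex" m i] by (simp add: add.commute)
  have half_nz: "pochhammer (1/2 :: complex) m \<noteq> 0"
    using fact_nonzero[of "2 * m", where 'a = complex] unfolding fact_double by simp
  have c: "pochhammer (of_nat m + 1 :: complex) (i + k) = fact n / fact m"
    using pochhammer_product'[of "1::complex" m "i + k"]
    by (simp add: n pochhammer_fact[symmetric] field_simps)
  have e: "2 * n - 2 * (m + i) = 2 * k" "n - (m + i) = k" "n - m = i + k" "n - m - i = k"
    by (simp_all add: n)
  have b: "of_nat (n choose m) = (fact n / (fact m * fact (i + k)) :: complex)"
    "of_nat ((m + i) choose m) = (fact (m + i) / (fact m * fact i) :: complex)"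
    "of_nat ((i + k) choose i) = (fact (i + k) / (fact i * fact k) :: complex)"
    by (simp_all add: binomial_fact n)
  show ?thesis
    unfolding a_coeff_def e b c central_binomial_pochhammer half
    using half_nz by (simp add: n power_add field_simps)
qed

theorem theorem2p1:
  fixes m n :: nat and x :: complex
  assumes "m \<le> n" and "norm x < 1 / 2"
  shows "Hl (1 / 2) ((2 * of_nat m + 1) * (of_nat m - of_nat n))
            (2 * (of_nat m - of_nat n)) (2 * of_nat m + 1)
            (of_nat m + 1) (of_nat m + 1) x
         = 4 ^ m * inverse (of_nat (n choose m)) * inverse (of_nat ((2 * m) choose m))
           * (\<Sum>j = 0..n - m. of_nat ((m + j) choose m) * a_coeff n (m + j) * (1 - 2 * x) ^ (2 * j))
         \<and> Hl (1 / 2) ((2 * of_nat m + 1) * (of_nat m - of_nat n))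
            (2 * (of_nat m - of_nat n)) (2 * of_nat m + 1)
            (of_nat m + 1) (of_nat m + 1) x
         = (\<Sum>j = 0..n - m. 4 ^ j * of_nat ((n - m) choose j)
              * (pochhammer (of_nat m + 1 / 2) j / pochhammer (of_nat m + 1) j)
              * (x ^ 2 - x) ^ j)"
    (is "?H = ?A \<and> ?H = ?B")
proof -
  define N where "N = n - m"
  let ?b = "of_nat m + 1 / 2 :: complex" and ?c = "of_nat m + 1 :: complex"
  have c: "?c \<noteq> - of_nat k" for k
    by (metis add_eq_0_iff2 of_nat_1 of_nat_add of_nat_eq_0_iff add_is_0 one_neq_zero)
  have N: "of_nat m - of_nat n = (- of_nat N :: complex)"
    using assms(1) by (simp add: N_def of_nat_diff)
  have HB: "?H = ?B"
    using Hl_hypergeometric_poly[OF c, of N ?b x]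
    unfolding N N_def[symmetric] by (simp add: algebra_simps)
  have "?B = (\<Sum>j=0..N. of_nat (N choose j) * (pochhammer ?b j / pochhammer ?c j) * ((1 - 2 * x)\<^sup>2 - 1) ^ j)"
  proof -
    have "(1 - 2 * x)\<^sup>2 - 1 = 4 * (x\<^sup>2 - x)" by (simp add: power2_eq_square algebra_simps)
    then show ?thesis by (simp only: N_def power_mult_distrib mult_ac)
  qed
  also have "\<dots> = (\<Sum>i=0..N. of_nat (N choose i) * (pochhammer ?b i * pochhammer (?c - ?b) (N - i)
      / pochhammer ?c N) * ((1 - 2 * x)\<^sup>2) ^ i)"
    by (rule hypergeometric_poly_reexpand[OF c])
  also have "\<dots> = ?A"
    unfolding sum_distrib_left N_def
  proof (rule sum.cong[OF refl])
    fix i assume "i \<in> {0..n - m}"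
    then show "of_nat ((n - m) choose i) * (pochhammer ?b i * pochhammer (?c - ?b) (n - m - i)
      / pochhammer ?c (n - m)) * ((1 - 2 * x)\<^sup>2) ^ i
      = 4 ^ m * inverse (of_nat (n choose m)) * inverse (of_nat ((2 * m) choose m)) *
         (of_nat ((m + i) choose m) * a_coeff n (m + i) * (1 - 2 * x) ^ (2 * i))"
      using reexpansion_coefficient[OF assms(1), of i]
      by (simp only: power_mult mult.assoc[symmetric]) simp
  qed
  finally show ?thesis using HB by simp
qed

end
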